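(* Assume that there exist $p>1$ and $C_1>0$ such that $\langle\mathcal A(w),w\rangle\ge C_1\|w\|^p$ for all $w\in\mathbb V$. If a two-stage or three-stage DIRK scheme is remarkably stable, then it is discretely Bochner stable when applied to the problem $\frac{du}{dt}=f(t)-\mathcal A(u)$, $u(0)=u_0$.
   Context: $\mathbb V\subset\mathbb H\subset\mathbb V^*$ is a Gelfand triple: $\mathbb H$ is a separable (real) Hilbert space with inner product $(\cdot,\cdot)$ and norm $|\cdot|$; $\mathbb V$ is a Banach space with norm $\|\cdot\|$, dual $\mathbb V^*$ with norm $\|\cdot\|_*$, and duality pairing $\langle\cdot,\cdot\rangle$; every $v\in\mathbb H$ is identified with the element of $\mathbb V^*$ given by $\langle v,w\rangle=(v,w)$ for all $w\in\mathbb V$. Let $t_f>0$, $u_0\in\mathbb H$, $f:[0,t_f]\to\mathbb V^*$ and $\mathcal A:\mathbb V\to\mathbb V^*$. Standing assumption (local solvability): for every $F\in\mathbb V^*$ there is $\beta>0$ such that for all $\gamma\in(0,\beta]$ the problem $v+\gamma\mathcal A(v)=F$ has a unique solution $v\in\mathbb V$. An $s$-stage DIRK scheme has a tableau with lower triangular matrix $\mathbf A=[a_{ij}]\in\mathbb R^{s\times s}$ with positive diagonal entries, weights $b_i\in[0,1]$ and nodes $c_i\in[0,1]$. For a partition $0=t_0<\dots<t_{\mathfrak N}=t_f$, $\tau_n=t_{n+1}-t_n$, it produces (equations in $\mathbb V^*$) $v_{n,i}=u_n+\tau_n\sum_{j=1}^i a_{ij}\mathscr F_{n,j}$ for $i=1,\dots,s$,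 $u_{n+1}=u_n+\tau_n\sum_{j=1}^s b_j\mathscr F_{n,j}$, where $f_{n,j}=f(t_n+c_j\tau_n)$, $\mathscr F_{n,j}=f_{n,j}-\mathcal A(v_{n,j})$, $v_{n,i}\in\mathbb V$, $u_n\in\mathbb H$. For $r\in(1,\infty)$, $r'=r/(r-1)$. Discrete Bochner stability: there are strictly positive $C_A,C_f$, $\{\omega_i\}_{i=1}^s$, $\{\gamma_i\}_{i=1}^s$, and $p>1$, $q\ge p$, such that for all $\mathfrak N\in\mathbb N$, any partition with $\mathfrak N$ steps and all $n\in\{0,\dots,\mathfrak N-1\}$, $$\tfrac12|u_{n+1}|^2+C_A\tau_n\sum_{i=1}^s\omega_i\|v_{n,i}\|^p\le\tfrac12|u_n|^2+C_f\tau_n\sum_{i=1}^s\gamma_i\|f_{n,i}\|_*^{q'}.$$ Remarkable stability, $s=2$: put $\lambda_1=\frac{b_1}{a_{11}}-\frac{b_2a_{21}}{a_{22}a_{11}}$, $\lambda_2=\frac{b_2}{a_{22}}$, $\delta_1=\frac12(\lambda_1+\lambda_2)(2-\lambda_1-\lambda_2)$, $\delta_2=\frac12\lambda_2(2-\lambda_2)$, $\nu_{11}=a_{11}[\lambda_1(1-\lambda_2)+\lambda_2(2-\lambda_2)]$, $\nu_{22}=a_{22}\lambda_2$, $\nu_{12}=\lambda_2[a_{21}+a_{11}(\lambda_1+\lambda_2-2)]$. The scheme is remarkably stable if $\delta_1\ge0$, $\delta_2\ge0$, $\nu_1=\nu_{11}+\nu_{12}>0$, $\nu_2=\nu_{22}>0$,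 and the quadratic form on $\mathbb H^3$ $$\mathcal Q(w_0,w_1,w_2)=\delta_1|w_1-w_0|^2+\delta_2|w_2-w_1|^2-\tfrac{\nu_{12}}{a_{11}}(w_1-w_0,w_2-w_1)$$ is nonnegative definite. Remarkable stability, $s=3$: put $$\lambda_1=\frac{b_1}{a_{11}}-\frac{b_2a_{21}}{a_{11}a_{22}}-\frac{b_3a_{31}}{a_{11}a_{33}}+\frac{b_3a_{32}a_{21}}{a_{11}a_{22}a_{33}},\quad \lambda_2=\frac{b_2}{a_{22}}-\frac{b_3a_{32}}{a_{22}a_{33}},\quad \lambda_3=\frac{b_3}{a_{33}},$$ $$\begin{aligned}\delta_1&=\tfrac12(\lambda_1+\lambda_2+\lambda_3)(2-\lambda_1-\lambda_2-\lambda_3),\quad \delta_2=\tfrac12(\lambda_2+\lambda_3)(2-\lambda_2-\lambda_3),\quad \delta_3=\tfrac12\lambda_3(2-\lambda_3),\\ \nu_{11}&=a_{11}\big(\lambda_1(1-\lambda_2-\lambda_3)+(2-\lambda_2-\lambda_3)(\lambda_2+\lambda_3)\big),\\ \nu_{22}&=a_{22}\big(\lambda_2(1-\lambda_3)+(2-\lambda_3)\lambda_3\big),\quad \nu_{33}=a_{33}\lambda_3,\\ \nu_{12}&=a_{21}\big(\lambda_2(1-\lambda_3)+(2-\lambda_3)\lambda_3\big)+a_{11}\big(\lambda_2(-2+\lambda_1+\lambda_2)+2(-1+\lambda_2)\lambda_3+\lambda_3^2\big),\\ \nu_{13}&=\lambda_3\big(a_{31}+a_{11}\lambda_1+a_{21}(-2+\lambda_2+\lambda_3)\big),\quad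 \nu_{23}=\lambda_3\big(a_{32}+a_{22}(-2+\lambda_2+\lambda_3)\big),\end{aligned}$$ and $\nu_i=\nu_{ii}+\sum_{j=i+1}^3\nu_{ij}$. The scheme is remarkably stable if $\delta_1,\delta_2,\delta_3\ge0$, $\nu_1,\nu_2,\nu_3>0$, and the quadratic form on $\mathbb H^4$ $$\begin{aligned}\mathcal Q(w_0,w_1,w_2,w_3)&=\delta_1|w_1-w_0|^2+\delta_2|w_2-w_1|^2+\delta_3|w_3-w_2|^2-\tfrac{\nu_{12}}{a_{11}}(w_1-w_0,w_2-w_1)\\&\quad-\tfrac{\nu_{13}}{a_{11}}(w_1-w_0,w_3-w_1)-\tfrac{\nu_{23}}{a_{22}}(w_2-w_0,w_3-w_2)+\tfrac{\nu_{23}a_{21}}{a_{11}a_{22}}(w_1-w_0,w_3-w_2)\end{aligned}$$ is nonnegative definite. (Nonnegative definite means $\mathcal Q\ge0$ everywhere.) *)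

theory Defs
  imports "HOL-Analysis.Analysis"
begin

text \<open>
  The spaces V and H are types, and the inclusion of V into H is an injective bounded linear map
  \<open>\<iota>\<close>.  The dual of V is the space \<open>'v \<Rightarrow>\<^sub>L real\<close> with the operator norm; the duality
  pairing is application.  Density of V in H is what makes \<open>dual_emb \<iota>\<close> injective, so that H
  can be regarded as a subspace of the dual of V.
\<close>

definition gelfand_triple ::
  "('v::banach \<Rightarrow>\<^sub>L 'h::{real_inner,complete_space}) \<Rightarrow> bool" where
  "gelfand_triple \<iota> \<longleftrightarrow>
     separable_space (euclidean :: 'h topology) \<and>
     inj (blinfun_apply \<iota>) \<and> closure (range (blinfun_apply \<iota>)) = UNIV"

definition dual_emb ::
  "('v::banach \<Rightarrow>\<^sub>L 'h::{real_inner,complete_space}) \<Rightarrow> 'h \<Rightarrow> ('v \<Rightarrow>\<^sub>L real)" where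
  "dual_emb \<iota> h = blinfun_inner_right h o\<^sub>L \<iota>"

lemma dual_emb_apply: "blinfun_apply (dual_emb \<iota> h) w = h \<bullet> \<iota> w"
  by (simp add: dual_emb_def)

definition locally_solvable ::
  "('v::banach \<Rightarrow>\<^sub>L 'h::{real_inner,complete_space}) \<Rightarrow> ('v \<Rightarrow> ('v \<Rightarrow>\<^sub>L real)) \<Rightarrow> bool" where
  "locally_solvable \<iota> \<A> \<longleftrightarrow>
     (\<forall>F :: 'v \<Rightarrow>\<^sub>L real. \<exists>\<beta>>0. \<forall>\<gamma>. 0 < \<gamma> \<and> \<gamma> \<le> \<beta> \<longrightarrow>
        (\<exists>!v. dual_emb \<iota> (\<iota> v) + \<gamma> *\<^sub>R \<A> v = F))"

text \<open>Stages are numbered from 1 to \<open>s\<close>; values of \<open>a\<close>, \<open>b\<close>, \<open>c\<close> at other indices are irrelevant.\<close>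

definition dirk_tableau ::
  "nat \<Rightarrow> (nat \<Rightarrow> nat \<Rightarrow> real) \<Rightarrow> (nat \<Rightarrow> real) \<Rightarrow> (nat \<Rightarrow> real) \<Rightarrow> bool" where
  "dirk_tableau s a b c \<longleftrightarrow>
     (\<forall>i\<in>{1..s}. \<forall>j\<in>{1..s}. i < j \<longrightarrow> a i j = 0) \<and>
     (\<forall>i\<in>{1..s}. a i i > 0) \<and>
     (\<forall>i\<in>{1..s}. b i \<in> {0..1}) \<and>
     (\<forall>i\<in>{1..s}. c i \<in> {0..1})"

definition time_partition :: "real \<Rightarrow> nat \<Rightarrow> (nat \<Rightarrow> real) \<Rightarrow> bool" where
  "time_partition tf N t \<longleftrightarrow> t 0 = 0 \<and> t N = tf \<and> (\<forall>n<N. t n < t (Suc n))"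

definition time_step :: "(nat \<Rightarrow> real) \<Rightarrow> nat \<Rightarrow> real" where
  "time_step t n = t (Suc n) - t n"

definition stage_load ::
  "(real \<Rightarrow> 'x) \<Rightarrow> (nat \<Rightarrow> real) \<Rightarrow> (nat \<Rightarrow> real) \<Rightarrow> nat \<Rightarrow> nat \<Rightarrow> 'x" where
  "stage_load f c t n j = f (t n + c j * time_step t n)"

text \<open>
  \<open>dirk_run \<dots> m u v\<close>: the values \<open>u 0, \<dots>, u m\<close> and the stages \<open>v n i\<close> with \<open>n < m\<close> result
  from \<open>m\<close> steps of the scheme.
\<close>

definition dirk_run ::
  "('v::banach \<Rightarrow>\<^sub>L 'h::{real_inner,complete_space}) \<Rightarrow> 'h \<Rightarrow>
   (real \<Rightarrow> ('v \<Rightarrow>\<^sub>L real)) \<Rightarrow> ('v \<Rightarrow> ('v \<Rightarrow>\<^sub>L real)) \<Rightarrow>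
   nat \<Rightarrow> (nat \<Rightarrow> nat \<Rightarrow> real) \<Rightarrow> (nat \<Rightarrow> real) \<Rightarrow> (nat \<Rightarrow> real) \<Rightarrow>
   (nat \<Rightarrow> real) \<Rightarrow> nat \<Rightarrow> (nat \<Rightarrow> 'h) \<Rightarrow> (nat \<Rightarrow> nat \<Rightarrow> 'v) \<Rightarrow> bool" where
  "dirk_run \<iota> u0 f \<A> s a b c t m u v \<longleftrightarrow>
     u 0 = u0 \<and>
     (\<forall>n<m.
        (\<forall>i\<in>{1..s}. dual_emb \<iota> (\<iota> (v n i)) = dual_emb \<iota> (u n) +
           time_step t n *\<^sub>R (\<Sum>j=1..i. a i j *\<^sub>R (stage_load f c t n j - \<A> (v n j)))) \<and>
        dual_emb \<iota> (u (Suc n)) = dual_emb \<iota> (u n) +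
          time_step t n *\<^sub>R (\<Sum>j=1..s. b j *\<^sub>R (stage_load f c t n j - \<A> (v n j))))"

text \<open>
  Local solvability does not yield existence or uniqueness of the discrete solution for large
  steps; the bound is therefore required of every solution, and at step \<open>n\<close> it presupposes only
  that the scheme has been carried out up to and including that step.  The conjugate exponent is
  \<open>q' = q / (q - 1)\<close>.
\<close>

definition discretely_Bochner_stable ::
  "('v::banach \<Rightarrow>\<^sub>L 'h::{real_inner,complete_space}) \<Rightarrow> real \<Rightarrow> 'h \<Rightarrow>
   (real \<Rightarrow> ('v \<Rightarrow>\<^sub>L real)) \<Rightarrow> ('v \<Rightarrow> ('v \<Rightarrow>\<^sub>L real)) \<Rightarrow>
   nat \<Rightarrow> (nat \<Rightarrow> nat \<Rightarrow> real) \<Rightarrow> (nat \<Rightarrow> real) \<Rightarrow> (nat \<Rightarrow> real) \<Rightarrow> bool" where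
  "discretely_Bochner_stable \<iota> tf u0 f \<A> s a b c \<longleftrightarrow>
     (\<exists>(CA::real) (Cf::real) (\<omega>::nat \<Rightarrow> real) (\<gamma>::nat \<Rightarrow> real) (p::real) (q::real).
        CA > 0 \<and> Cf > 0 \<and> (\<forall>i\<in>{1..s}. \<omega> i > 0 \<and> \<gamma> i > 0) \<and> p > 1 \<and> q \<ge> p \<and>
        (\<forall>N t. time_partition tf N t \<longrightarrow>
          (\<forall>n<N. \<forall>u v. dirk_run \<iota> u0 f \<A> s a b c t (Suc n) u v \<longrightarrow>
             (1/2) * (norm (u (Suc n)))\<^sup>2 +
               CA * time_step t n * (\<Sum>i=1..s. \<omega> i * norm (v n i) powr p)
             \<le> (1/2) * (norm (u n))\<^sup>2 +
               Cf * time_step t n *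
                 (\<Sum>i=1..s. \<gamma> i * norm (stage_load f c t n i) powr (q / (q - 1))))))"

text \<open>
  The type argument is the Hilbert space over which the quadratic form ranges.
  The \<open>l\<^sub>i\<close> are the coefficients in \<open>u\<^sub>n\<^sub>+\<^sub>1 = u\<^sub>n + (\<Sum>i. l\<^sub>i (v\<^sub>n\<^sub>,\<^sub>i - u\<^sub>n))\<close>.
\<close>

definition remarkably_stable2 ::
  "'h::{real_inner,complete_space} itself \<Rightarrow> (nat \<Rightarrow> nat \<Rightarrow> real) \<Rightarrow> (nat \<Rightarrow> real) \<Rightarrow> bool" where
  "remarkably_stable2 TYPE('h) a b \<longleftrightarrow>
    (let
       l1 = b 1 / a 1 1 - b 2 * a 2 1 / (a 2 2 * a 1 1);
       l2 = b 2 / a 2 2;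
       \<delta>1 = (1/2) * (l1 + l2) * (2 - l1 - l2);
       \<delta>2 = (1/2) * l2 * (2 - l2);
       \<nu>11 = a 1 1 * (l1 * (1 - l2) + l2 * (2 - l2));
       \<nu>22 = a 2 2 * l2;
       \<nu>12 = l2 * (a 2 1 + a 1 1 * (l1 + l2 - 2));
       \<nu>1 = \<nu>11 + \<nu>12;
       \<nu>2 = \<nu>22
     in \<delta>1 \<ge> 0 \<and> \<delta>2 \<ge> 0 \<and> \<nu>1 > 0 \<and> \<nu>2 > 0 \<and>
        (\<forall>w0 w1 w2 :: 'h.
           \<delta>1 * (norm (w1 - w0))\<^sup>2 + \<delta>2 * (norm (w2 - w1))\<^sup>2
           - \<nu>12 / a 1 1 * ((w1 - w0) \<bullet> (w2 - w1)) \<ge> 0))"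

definition remarkably_stable3 ::
  "'h::{real_inner,complete_space} itself \<Rightarrow> (nat \<Rightarrow> nat \<Rightarrow> real) \<Rightarrow> (nat \<Rightarrow> real) \<Rightarrow> bool" where
  "remarkably_stable3 TYPE('h) a b \<longleftrightarrow>
    (let
       l1 = b 1 / a 1 1 - b 2 * a 2 1 / (a 1 1 * a 2 2) - b 3 * a 3 1 / (a 1 1 * a 3 3)
            + b 3 * a 3 2 * a 2 1 / (a 1 1 * a 2 2 * a 3 3);
       l2 = b 2 / a 2 2 - b 3 * a 3 2 / (a 2 2 * a 3 3);
       l3 = b 3 / a 3 3;
       \<delta>1 = (1/2) * (l1 + l2 + l3) * (2 - l1 - l2 - l3);
       \<delta>2 = (1/2) * (l2 + l3) * (2 - l2 - l3);
       \<delta>3 = (1/2) * l3 * (2 - l3);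
       \<nu>11 = a 1 1 * (l1 * (1 - l2 - l3) + (2 - l2 - l3) * (l2 + l3));
       \<nu>22 = a 2 2 * (l2 * (1 - l3) + (2 - l3) * l3);
       \<nu>33 = a 3 3 * l3;
       \<nu>12 = a 2 1 * (l2 * (1 - l3) + (2 - l3) * l3)
             + a 1 1 * (l2 * (- 2 + l1 + l2) + 2 * (- 1 + l2) * l3 + l3\<^sup>2);
       \<nu>13 = l3 * (a 3 1 + a 1 1 * l1 + a 2 1 * (- 2 + l2 + l3));
       \<nu>23 = l3 * (a 3 2 + a 2 2 * (- 2 + l2 + l3));
       \<nu>1 = \<nu>11 + \<nu>12 + \<nu>13;
       \<nu>2 = \<nu>22 + \<nu>23;
       \<nu>3 = \<nu>33
     in \<delta>1 \<ge> 0 \<and> \<delta>2 \<ge> 0 \<and> \<delta>3 \<ge> 0 \<and> \<nu>1 > 0 \<and> \<nu>2 > 0 \<and> \<nu>3 > 0 \<and>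
        (\<forall>w0 w1 w2 w3 :: 'h.
           \<delta>1 * (norm (w1 - w0))\<^sup>2 + \<delta>2 * (norm (w2 - w1))\<^sup>2 + \<delta>3 * (norm (w3 - w2))\<^sup>2
           - \<nu>12 / a 1 1 * ((w1 - w0) \<bullet> (w2 - w1))
           - \<nu>13 / a 1 1 * ((w1 - w0) \<bullet> (w3 - w1))
           - \<nu>23 / a 2 2 * ((w2 - w0) \<bullet> (w3 - w2))
           + \<nu>23 * a 2 1 / (a 1 1 * a 2 2) * ((w1 - w0) \<bullet> (w3 - w2)) \<ge> 0))"

definition remarkably_stable ::
  "'h::{real_inner,complete_space} itself \<Rightarrow> nat \<Rightarrow> (nat \<Rightarrow> nat \<Rightarrow> real) \<Rightarrow> (nat \<Rightarrow> real) \<Rightarrow> bool"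
  where
  "remarkably_stable TYPE('h) s a b \<longleftrightarrow>
     s = 2 \<and> remarkably_stable2 TYPE('h) a b \<or> s = 3 \<and> remarkably_stable3 TYPE('h) a b"

end

theory Submission
  imports Defs
begin

text \<open>
  Every stage slope \<open>\<tau>\<^sub>n \<F>\<^sub>n\<^sub>,\<^sub>i\<close> is represented by an element \<open>G\<^sub>i\<close> of H, because the stage equations
  form a triangular system with nonzero diagonal.  Testing the slope with \<open>v\<^sub>n\<^sub>,\<^sub>i\<close> thus becomes an
  inner product in H, and one polynomial identity yields
  \<open>|u\<^sub>n\<^sub>+\<^sub>1|\<^sup>2 / 2 + Q = |u\<^sub>n|\<^sup>2 / 2 + \<tau>\<^sub>n (\<Sum>i. \<nu>\<^sub>i \<langle>\<F>\<^sub>n\<^sub>,\<^sub>i, v\<^sub>n\<^sub>,\<^sub>i\<rangle>)\<close> with the quadratic form \<open>Q\<close> of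
  remarkable stability; the two-stage case is the three-stage one with \<open>\<lambda>\<^sub>3 = 0\<close>.
  Dropping \<open>Q \<ge> 0\<close>, coercivity and Young's inequality give the bound with \<open>q = p\<close>.
\<close>

section \<open>From equations in the dual of V to equations in H\<close>

lemma linear_dual_emb: "linear (dual_emb \<iota>)"
  by (rule linearI; rule blinfun_eqI)
    (simp_all add: dual_emb_apply blinfun.add_left blinfun.scaleR_left inner_add_left)

text \<open>An \<open>h\<close> sent to zero is orthogonal to the range of \<open>\<iota>\<close>.
  The vectors orthogonal to \<open>h\<close> form a closed set, so density makes every vector
  orthogonal to \<open>h\<close>, in particular \<open>h\<close> itself.\<close>

lemma inj_dual_emb:
  assumes "closure (range (blinfun_apply \<iota>)) = UNIV"
  shows "inj (dual_emb \<iota>)"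
proof (subst linear_inj_iff_eq_0[OF linear_dual_emb], intro allI impI)
  fix h assume "dual_emb \<iota> h = 0"
  then have "h \<bullet> \<iota> w = 0" for w
    by (metis dual_emb_apply zero_blinfun.rep_eq)
  then have "range \<iota> \<subseteq> {x. h \<bullet> x = 0}"
    by auto
  then have "closure (range \<iota>) \<subseteq> {x. h \<bullet> x = 0}"
    by (intro closure_minimal closed_hyperplane)
  then have "h \<in> {x. h \<bullet> x = 0}"
    using assms by blast
  then show "h = 0"
    by simp
qed

text \<open>Forward substitution: equation \<open>i\<close> expresses \<open>a i i\<close> times
  slope \<open>i\<close> through embedded elements of H and earlier slopes, so all slopes lie in the
  range of the embedding. Injectivity then carries the stage and step equations over to H.\<close>

lemma dirk_run_slopes:
  assumes "gelfand_triple \<iota>" "dirk_tableau s a b c"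
    and run: "dirk_run \<iota> u0 f \<A> s a b c t m u v" and "n < m"
  obtains G where
    "\<And>i. i \<in> {1..s} \<Longrightarrow>
       G i \<bullet> \<iota> (v n i) = time_step t n * (stage_load f c t n i - \<A> (v n i)) (v n i)"
    "\<And>i. i \<in> {1..s} \<Longrightarrow> \<iota> (v n i) = u n + (\<Sum>j=1..i. a i j *\<^sub>R G j)"
    "u (Suc n) = u n + (\<Sum>j=1..s. b j *\<^sub>R G j)"
proof -
  interpret linear "dual_emb \<iota>"
    by (rule linear_dual_emb)
  have inj: "inj (dual_emb \<iota>)"
    using assms(1) inj_dual_emb by (auto simp: gelfand_triple_def)
  \<comment> \<open>The step size is absorbed into \<open>S\<close>, so that the equations for
    \<open>S\<close> contain tableau entries alone.\<close>
  define S where "S j = time_step t n *\<^sub>R (stage_load f c t n j - \<A> (v n j))" for j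
  have S_sum: "time_step t n *\<^sub>R (\<Sum>j=1..k. x j *\<^sub>R (stage_load f c t n j - \<A> (v n j)))
      = (\<Sum>j=1..k. x j *\<^sub>R S j)" for x k
    by (simp add: S_def scaleR_sum_right mult.commute)
  have stage: "dual_emb \<iota> (\<iota> (v n i)) = dual_emb \<iota> (u n) + (\<Sum>j=1..i. a i j *\<^sub>R S j)"
    if "i \<in> {1..s}" for i
    unfolding S_sum[symmetric] using run \<open>n < m\<close> that by (simp add: dirk_run_def)
  have step: "dual_emb \<iota> (u (Suc n)) = dual_emb \<iota> (u n) + (\<Sum>j=1..s. b j *\<^sub>R S j)"
    unfolding S_sum[symmetric] using run \<open>n < m\<close> by (simp add: dirk_run_def)
  have "S i \<in> range (dual_emb \<iota>)" if "i \<in> {1..s}" for i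
    using that
  proof (induction i rule: less_induct)
    case (less i)
    have "a i i \<noteq> 0"
      using assms(2) less.prems unfolding dirk_tableau_def by (metis less_irrefl)
    have ran: "subspace (range (dual_emb \<iota>))"
      by (rule linear_subspace_image[OF linear_dual_emb subspace_UNIV])
    \<comment> \<open>With the diagonal term split off, the remaining indices \<open>j < i\<close>
      fall under the induction hypothesis; for the first stage none remain.\<close>
    have split: "(\<Sum>j=1..i. a i j *\<^sub>R S j) = a i i *\<^sub>R S i + (\<Sum>j=1..<i. a i j *\<^sub>R S j)"
      using less.prems by (simp add: sum.last_plus)
    have "a i i *\<^sub>R S i = dual_emb \<iota> (\<iota> (v n i)) - dual_emb \<iota> (u n) - (\<Sum>j=1..<i. a i j *\<^sub>R S j)"
      unfolding stage[OF less.prems] split by simp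
    also have "\<dots> \<in> range (dual_emb \<iota>)"
    proof (intro subspace_diff[OF ran] subspace_sum[OF ran] subspace_scale[OF ran] rangeI)
      show "S j \<in> range (dual_emb \<iota>)" if "j \<in> {1..<i}" for j
        using that less.prems by (intro less.IH) simp_all
    qed
    finally have "(1 / a i i) *\<^sub>R a i i *\<^sub>R S i \<in> range (dual_emb \<iota>)"
      by (rule subspace_scale[OF ran])
    then show ?case
      using \<open>a i i \<noteq> 0\<close> by simp
  qed
  \<comment> \<open>\<open>inv\<close> gives a true preimage only on the range, hence only for stage
    indices; the sums below stay within these because \<open>j \<le> i \<le> s\<close>.\<close>
  then have G: "dual_emb \<iota> (inv (dual_emb \<iota>) (S i)) = S i" if "i \<in> {1..s}" for i
    using that by (intro f_inv_into_f)
  show thesis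
  proof (rule that[of "\<lambda>i. inv (dual_emb \<iota>) (S i)"])
    show "inv (dual_emb \<iota>) (S i) \<bullet> \<iota> (v n i)
        = time_step t n * (stage_load f c t n i - \<A> (v n i)) (v n i)"
      if "i \<in> {1..s}" for i
      unfolding dual_emb_apply[symmetric] G[OF that] by (simp add: S_def blinfun.scaleR_left)
    show "\<iota> (v n i) = u n + (\<Sum>j=1..i. a i j *\<^sub>R inv (dual_emb \<iota>) (S j))"
      if "i \<in> {1..s}" for i
    proof (rule injD[OF inj])
      have "(\<Sum>j=1..i. a i j *\<^sub>R dual_emb \<iota> (inv (dual_emb \<iota>) (S j))) = (\<Sum>j=1..i. a i j *\<^sub>R S j)"
        using that by (intro sum.cong refl arg_cong[of _ _ "scaleR _"] G) simp
      then show "dual_emb \<iota> (\<iota> (v n i))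
          = dual_emb \<iota> (u n + (\<Sum>j=1..i. a i j *\<^sub>R inv (dual_emb \<iota>) (S j)))"
        unfolding stage[OF that] add sum scale by simp
    qed
    show "u (Suc n) = u n + (\<Sum>j=1..s. b j *\<^sub>R inv (dual_emb \<iota>) (S j))"
    proof (rule injD[OF inj])
      have "(\<Sum>j=1..s. b j *\<^sub>R dual_emb \<iota> (inv (dual_emb \<iota>) (S j))) = (\<Sum>j=1..s. b j *\<^sub>R S j)"
        by (intro sum.cong refl arg_cong[of _ _ "scaleR _"] G) simp
      then show "dual_emb \<iota> (u (Suc n))
          = dual_emb \<iota> (u n + (\<Sum>j=1..s. b j *\<^sub>R inv (dual_emb \<iota>) (S j)))"
        unfolding step add sum scale by simp
    qed
  qed
qed

section \<open>Absorbing the load by coercivity\<close>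

text \<open>Young's inequality is applied to \<open>C powr (1 / p) * y\<close> and
  \<open>x / C powr (1 / p)\<close>, whose product is \<open>x * y\<close>. The first power yields
  the prescribed factor \<open>C\<close>, the second determines \<open>K\<close>, which depends on
  \<open>p\<close> and \<open>C\<close> only.\<close>

lemma Young_weighted:
  fixes p C :: real
  assumes "p > 1" "C > 0"
  obtains K where "K > 0"
    "\<And>x y. x \<ge> 0 \<Longrightarrow> y \<ge> 0 \<Longrightarrow> x * y \<le> C * y powr p + K * x powr (p / (p - 1))"
proof
  let ?q = "p / (p - 1)" and ?k = "C powr (1 / p)"
  show "(1 / ?k) powr ?q > 0"
    using assms by simp
  fix x y :: real
  assume "x \<ge> 0" "y \<ge> 0"
  have "?q > 1" and conj: "1 / p + 1 / ?q = 1"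
    using assms by (auto simp: field_simps)
  \<comment> \<open>The divisors \<open>p\<close> and \<open>p / (p - 1)\<close> in Young's
    inequality exceed 1, so dropping them only enlarges the bound.\<close>
  have shrink: "z / r \<le> z" if "z \<ge> 0" "r > 1" for z r :: real
    using mult_left_mono[of 1 r z] that by (simp add: divide_le_eq)
  have "x * y = (?k * y) * (1 / ?k * x)"
    using assms by simp
  also have "\<dots> \<le> (?k * y) powr p / p + (1 / ?k * x) powr ?q / ?q"
    using assms \<open>x \<ge> 0\<close> \<open>y \<ge> 0\<close> \<open>?q > 1\<close> conj by (intro Youngs_inequality) auto
  also have "\<dots> \<le> (?k * y) powr p + (1 / ?k * x) powr ?q"
    using \<open>?q > 1\<close> assms(1) by (intro add_mono shrink) auto
  also have "(?k * y) powr p = C * y powr p"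
    using assms \<open>y \<ge> 0\<close> by (simp add: powr_mult powr_powr)
  also have "(1 / ?k * x) powr ?q = (1 / ?k) powr ?q * x powr ?q"
    using \<open>x \<ge> 0\<close> by (subst powr_mult) auto
  finally show "x * y \<le> C * y powr p + (1 / ?k) powr ?q * x powr ?q" .
qed

text \<open>Isolates the part common to two and three stages: an energy inequality with positive
  weights suffices, because coercivity controls each pairing separately.\<close>

lemma discretely_Bochner_stableI:
  fixes \<A> :: "'v::banach \<Rightarrow> ('v \<Rightarrow>\<^sub>L real)"
  assumes "p > 1" "C > 0" and coercive: "\<And>w. \<A> w w \<ge> C * norm w powr p"
    and pos: "\<And>i. i \<in> {1..s} \<Longrightarrow> \<nu> i > 0"
    and energy: "\<And>t m u v n. dirk_run \<iota> u0 f \<A> s a b c t m u v \<Longrightarrow> n < m \<Longrightarrow>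
      (1/2) * (norm (u (Suc n)))\<^sup>2 \<le> (1/2) * (norm (u n))\<^sup>2 +
        time_step t n * (\<Sum>i=1..s. \<nu> i * (stage_load f c t n i - \<A> (v n i)) (v n i))"
  shows "discretely_Bochner_stable \<iota> tf u0 f \<A> s a b c"
proof -
  \<comment> \<open>With \<open>C / 2\<close> in Young's inequality, half of the coercive term
    absorbs the load and the other half survives on the left.\<close>
  obtain K where K: "K > 0"
    "\<And>x y. x \<ge> 0 \<Longrightarrow> y \<ge> 0 \<Longrightarrow> x * y \<le> C / 2 * y powr p + K * x powr (p / (p - 1))"
    using Young_weighted[of p "C / 2"] assms(1,2) by auto
  have slope: "(g - \<A> w) w \<le> K * norm g powr (p / (p - 1)) - C / 2 * norm w powr p" for g w
  proof -
    have "g w \<le> norm g * norm w"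
      using norm_blinfun[of g w] by simp
    with K(2)[of "norm g" "norm w"] coercive[of w] show ?thesis
      by (simp add: blinfun.diff_left)
  qed
  have "(1/2) * (norm (u (Suc n)))\<^sup>2 + C / 2 * time_step t n * (\<Sum>i=1..s. \<nu> i * norm (v n i) powr p)
      \<le> (1/2) * (norm (u n))\<^sup>2 +
        K * time_step t n * (\<Sum>i=1..s. \<nu> i * norm (stage_load f c t n i) powr (p / (p - 1)))"
    if part: "time_partition tf N t" and "n < N"
      and run: "dirk_run \<iota> u0 f \<A> s a b c t (Suc n) u v" for N t n u v
  proof -
    have "time_step t n \<ge> 0"
      using part \<open>n < N\<close> by (auto simp: time_partition_def time_step_def less_imp_le)
    then have "time_step t n * (\<Sum>i=1..s. \<nu> i * (stage_load f c t n i - \<A> (v n i)) (v n i))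
      \<le> time_step t n * (\<Sum>i=1..s. \<nu> i *
          (K * norm (stage_load f c t n i) powr (p / (p - 1)) - C / 2 * norm (v n i) powr p))"
      using pos by (intro mult_left_mono sum_mono slope) (auto intro: less_imp_le)
    also have "\<dots> =
        K * time_step t n * (\<Sum>i=1..s. \<nu> i * norm (stage_load f c t n i) powr (p / (p - 1)))
      - C / 2 * time_step t n * (\<Sum>i=1..s. \<nu> i * norm (v n i) powr p)"
      by (simp add: sum_distrib_left sum_subtractf right_diff_distrib mult_ac)
    finally show ?thesis
      using energy[OF run, of n] by simp
  qed
  \<comment> \<open>The witnesses are \<open>CA = C / 2\<close>, \<open>Cf = K\<close>,
    \<open>\<omega> = \<gamma> = \<nu>\<close> and \<open>q = p\<close>.\<close>
  then show ?thesis
    unfolding discretely_Bochner_stable_def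
    using assms(1,2) K(1) pos
    by (intro exI[of _ "C / 2"] exI[of _ K] exI[of _ \<nu>] exI[of _ p]) auto
qed

section \<open>Energy balance of one step\<close>

text \<open>The balance naturally has the terms \<open>\<nu>ij * (gi \<bullet> wj)\<close> with
  \<open>i \<le> j\<close> on the right. Coercivity sees only \<open>gi \<bullet> wi\<close>, so
  each mixed term is replaced by \<open>\<nu>ij * (gi \<bullet> wi)\<close> and its remainder in
  \<open>wj - wi\<close> joins the quadratic form; this is why the weights are row sums. Writing the
  form with \<open>g1\<close> and \<open>g2\<close> avoids division, so zero tableau entries are
  allowed.\<close>

lemma energy_identity:
  fixes w0 w1 w2 w3 g1 g2 g3 :: "'h::real_inner"
  assumes w1: "w1 = w0 + a11 *\<^sub>R g1"
    and w2: "w2 = w0 + a21 *\<^sub>R g1 + a22 *\<^sub>R g2"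
    and w3: "w3 = w0 + a31 *\<^sub>R g1 + a32 *\<^sub>R g2 + a33 *\<^sub>R g3"
    and \<delta>: "\<delta>1 = (1/2) * (l1 + l2 + l3) * (2 - l1 - l2 - l3)"
      "\<delta>2 = (1/2) * (l2 + l3) * (2 - l2 - l3)"
      "\<delta>3 = (1/2) * l3 * (2 - l3)"
    and \<nu>: "\<nu>11 = a11 * (l1 * (1 - l2 - l3) + (2 - l2 - l3) * (l2 + l3))"
      "\<nu>22 = a22 * (l2 * (1 - l3) + (2 - l3) * l3)"
      "\<nu>33 = a33 * l3"
      "\<nu>12 = a21 * (l2 * (1 - l3) + (2 - l3) * l3)
        + a11 * (l2 * (- 2 + l1 + l2) + 2 * (- 1 + l2) * l3 + l3\<^sup>2)"
      "\<nu>13 = l3 * (a31 + a11 * l1 + a21 * (- 2 + l2 + l3))"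
      "\<nu>23 = l3 * (a32 + a22 * (- 2 + l2 + l3))"
  shows "(1/2) * (norm (w0 + l1 *\<^sub>R (w1 - w0) + l2 *\<^sub>R (w2 - w0) + l3 *\<^sub>R (w3 - w0)))\<^sup>2
      + (\<delta>1 * (norm (w1 - w0))\<^sup>2 + \<delta>2 * (norm (w2 - w1))\<^sup>2 + \<delta>3 * (norm (w3 - w2))\<^sup>2
         - \<nu>12 * (g1 \<bullet> (w2 - w1)) - \<nu>13 * (g1 \<bullet> (w3 - w1)) - \<nu>23 * (g2 \<bullet> (w3 - w2)))
    = (1/2) * (norm w0)\<^sup>2
      + ((\<nu>11 + \<nu>12 + \<nu>13) * (g1 \<bullet> w1) + (\<nu>22 + \<nu>23) * (g2 \<bullet> w2) + \<nu>33 * (g3 \<bullet> w3))"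
proof -
  \<comment> \<open>One order is fixed for each mixed product; after bilinear expansion the inner
    products act as atoms whose coefficients are compared.\<close>
  note comm = inner_commute[of g1 w0] inner_commute[of g2 w0] inner_commute[of g3 w0]
    inner_commute[of g2 g1] inner_commute[of g3 g1] inner_commute[of g3 g2]
  show ?thesis
    unfolding w1 w2 w3 \<delta> \<nu> power2_norm_eq_inner
    by (simp add: inner_add_left inner_add_right inner_diff_left inner_diff_right comm) (simp add: algebra_simps power2_eq_square add_divide_distrib diff_divide_distrib)
qed

section \<open>Energy inequalities from remarkable stability\<close>

lemma remarkably_stable3_energy:
  fixes a :: "nat \<Rightarrow> nat \<Rightarrow> real" and b :: "nat \<Rightarrow> real"
  assumes rs: "remarkably_stable3 TYPE('h::{real_inner,complete_space}) a b"
    and nz: "a 1 1 \<noteq> 0" "a 2 2 \<noteq> 0" "a 3 3 \<noteq> 0"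
  obtains \<nu>1 \<nu>2 \<nu>3 where "\<nu>1 > 0" "\<nu>2 > 0" "\<nu>3 > 0"
    "\<And>w0 w1 w2 w3 g1 g2 g3 :: 'h.
       w1 = w0 + a 1 1 *\<^sub>R g1 \<Longrightarrow>
       w2 = w0 + a 2 1 *\<^sub>R g1 + a 2 2 *\<^sub>R g2 \<Longrightarrow>
       w3 = w0 + a 3 1 *\<^sub>R g1 + a 3 2 *\<^sub>R g2 + a 3 3 *\<^sub>R g3 \<Longrightarrow>
       (1/2) * (norm (w0 + b 1 *\<^sub>R g1 + b 2 *\<^sub>R g2 + b 3 *\<^sub>R g3))\<^sup>2
         \<le> (1/2) * (norm w0)\<^sup>2 + (\<nu>1 * (g1 \<bullet> w1) + \<nu>2 * (g2 \<bullet> w2) + \<nu>3 * (g3 \<bullet> w3))"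
proof -
  define l1 where "l1 = b 1 / a 1 1 - b 2 * a 2 1 / (a 1 1 * a 2 2)
    - b 3 * a 3 1 / (a 1 1 * a 3 3) + b 3 * a 3 2 * a 2 1 / (a 1 1 * a 2 2 * a 3 3)"
  define l2 where "l2 = b 2 / a 2 2 - b 3 * a 3 2 / (a 2 2 * a 3 3)"
  define l3 where "l3 = b 3 / a 3 3"
  define \<delta>1 where "\<delta>1 = (1/2) * (l1 + l2 + l3) * (2 - l1 - l2 - l3)"
  define \<delta>2 where "\<delta>2 = (1/2) * (l2 + l3) * (2 - l2 - l3)"
  define \<delta>3 where "\<delta>3 = (1/2) * l3 * (2 - l3)"
  define \<nu>11 where "\<nu>11 = a 1 1 * (l1 * (1 - l2 - l3) + (2 - l2 - l3) * (l2 + l3))"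
  define \<nu>22 where "\<nu>22 = a 2 2 * (l2 * (1 - l3) + (2 - l3) * l3)"
  define \<nu>33 where "\<nu>33 = a 3 3 * l3"
  define \<nu>12 where "\<nu>12 = a 2 1 * (l2 * (1 - l3) + (2 - l3) * l3)
    + a 1 1 * (l2 * (- 2 + l1 + l2) + 2 * (- 1 + l2) * l3 + l3\<^sup>2)"
  define \<nu>13 where "\<nu>13 = l3 * (a 3 1 + a 1 1 * l1 + a 2 1 * (- 2 + l2 + l3))"
  define \<nu>23 where "\<nu>23 = l3 * (a 3 2 + a 2 2 * (- 2 + l2 + l3))"
  note stable = rs[unfolded remarkably_stable3_def Let_def, folded l1_def l2_def l3_def,
      folded \<delta>1_def \<delta>2_def \<delta>3_def \<nu>11_def \<nu>22_def \<nu>33_def \<nu>12_def \<nu>13_def \<nu>23_def]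
  \<comment> \<open>The \<open>l\<close>s solve the transposed tableau system, which turns the
    update by slopes into one by the differences \<open>wi - w0\<close>.\<close>
  have b: "b 1 = l1 * a 1 1 + l2 * a 2 1 + l3 * a 3 1" "b 2 = l2 * a 2 2 + l3 * a 3 2"
    "b 3 = l3 * a 3 3"
    using nz by (simp_all add: l1_def l2_def l3_def field_simps)
  show thesis
  proof
    show "\<nu>11 + \<nu>12 + \<nu>13 > 0" "\<nu>22 + \<nu>23 > 0" "\<nu>33 > 0"
      using stable by blast+
    fix w0 w1 w2 w3 g1 g2 g3 :: 'h
    assume w1: "w1 = w0 + a 1 1 *\<^sub>R g1"
      and w2: "w2 = w0 + a 2 1 *\<^sub>R g1 + a 2 2 *\<^sub>R g2"
      and w3: "w3 = w0 + a 3 1 *\<^sub>R g1 + a 3 2 *\<^sub>R g2 + a 3 3 *\<^sub>R g3"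
    have "w0 + b 1 *\<^sub>R g1 + b 2 *\<^sub>R g2 + b 3 *\<^sub>R g3
        = w0 + l1 *\<^sub>R (w1 - w0) + l2 *\<^sub>R (w2 - w0) + l3 *\<^sub>R (w3 - w0)"
      unfolding w1 w2 w3 b by (simp add: scaleR_add_left scaleR_add_right)
    moreover have "k / a 1 1 * ((w1 - w0) \<bullet> x) = k * (g1 \<bullet> x)" for k x
      using nz by (simp add: w1)
    \<comment> \<open>Solving the second stage for \<open>g2\<close> shows that the last two terms
      of the quadratic form combine into
      \<open>- \<nu>23 * (g2 \<bullet> (w3 - w2))\<close>.\<close>
    moreover have "k / a 2 2 * ((w2 - w0) \<bullet> x) - k * a 2 1 / (a 1 1 * a 2 2) * ((w1 - w0) \<bullet> x)
        = k * (g2 \<bullet> x)" for k x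
      using nz by (simp add: w1 w2 inner_add_left distrib_left)
    ultimately show "(1/2) * (norm (w0 + b 1 *\<^sub>R g1 + b 2 *\<^sub>R g2 + b 3 *\<^sub>R g3))\<^sup>2
        \<le> (1/2) * (norm w0)\<^sup>2
          + ((\<nu>11 + \<nu>12 + \<nu>13) * (g1 \<bullet> w1) + (\<nu>22 + \<nu>23) * (g2 \<bullet> w2) + \<nu>33 * (g3 \<bullet> w3))"
      \<comment> \<open>Behind the six sign conditions stands the nonnegativity of the form, taken
        at the stage values; its variables occur in the order \<open>w1\<close>, \<open>w0\<close>,
        \<open>w2\<close>, \<open>w3\<close>.\<close>
      using stable[THEN conjunct2, THEN conjunct2, THEN conjunct2, THEN conjunct2,
          THEN conjunct2, THEN conjunct2, rule_format, of w1 w0 w2 w3]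
        energy_identity[OF w1 w2 w3 \<delta>1_def \<delta>2_def \<delta>3_def
          \<nu>11_def \<nu>22_def \<nu>33_def \<nu>12_def \<nu>13_def \<nu>23_def]
      by (smt (verit))
  qed
qed

lemma remarkably_stable2_energy:
  fixes a :: "nat \<Rightarrow> nat \<Rightarrow> real" and b :: "nat \<Rightarrow> real"
  assumes rs: "remarkably_stable2 TYPE('h::{real_inner,complete_space}) a b"
    and nz: "a 1 1 \<noteq> 0" "a 2 2 \<noteq> 0"
  obtains \<nu>1 \<nu>2 where "\<nu>1 > 0" "\<nu>2 > 0"
    "\<And>w0 w1 w2 g1 g2 :: 'h.
       w1 = w0 + a 1 1 *\<^sub>R g1 \<Longrightarrow>
       w2 = w0 + a 2 1 *\<^sub>R g1 + a 2 2 *\<^sub>R g2 \<Longrightarrow>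
       (1/2) * (norm (w0 + b 1 *\<^sub>R g1 + b 2 *\<^sub>R g2))\<^sup>2
         \<le> (1/2) * (norm w0)\<^sup>2 + (\<nu>1 * (g1 \<bullet> w1) + \<nu>2 * (g2 \<bullet> w2))"
proof -
  define l1 where "l1 = b 1 / a 1 1 - b 2 * a 2 1 / (a 2 2 * a 1 1)"
  define l2 where "l2 = b 2 / a 2 2"
  define \<delta>1 where "\<delta>1 = (1/2) * (l1 + l2) * (2 - l1 - l2)"
  define \<delta>2 where "\<delta>2 = (1/2) * l2 * (2 - l2)"
  define \<nu>11 where "\<nu>11 = a 1 1 * (l1 * (1 - l2) + l2 * (2 - l2))"
  define \<nu>22 where "\<nu>22 = a 2 2 * l2"
  define \<nu>12 where "\<nu>12 = l2 * (a 2 1 + a 1 1 * (l1 + l2 - 2))"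
  note stable = rs[unfolded remarkably_stable2_def Let_def, folded l1_def l2_def,
      folded \<delta>1_def \<delta>2_def \<nu>11_def \<nu>22_def \<nu>12_def]
  have b: "b 1 = l1 * a 1 1 + l2 * a 2 1" "b 2 = l2 * a 2 2"
    using nz by (simp_all add: l1_def l2_def field_simps)
  show thesis
  proof
    show "\<nu>11 + \<nu>12 > 0" "\<nu>22 > 0"
      using stable by blast+
    fix w0 w1 w2 g1 g2 :: 'h
    assume w1: "w1 = w0 + a 1 1 *\<^sub>R g1"
      and w2: "w2 = w0 + a 2 1 *\<^sub>R g1 + a 2 2 *\<^sub>R g2"
    have "w0 + b 1 *\<^sub>R g1 + b 2 *\<^sub>R g2 = w0 + l1 *\<^sub>R (w1 - w0) + l2 *\<^sub>R (w2 - w0)"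
      unfolding w1 w2 b by (simp add: scaleR_add_left scaleR_add_right)
    moreover have "\<nu>12 / a 1 1 * ((w1 - w0) \<bullet> x) = \<nu>12 * (g1 \<bullet> x)" for x
      using nz by (simp add: w1)
    \<comment> \<open>The third stage is switched off by \<open>w3 = w0\<close>,
      \<open>g3 = 0\<close>, a zero tableau row and \<open>l3 = 0\<close>; the three-stage
      coefficients then become the two-stage ones.\<close>
    moreover have "(1/2) * (norm (w0 + l1 *\<^sub>R (w1 - w0) + l2 *\<^sub>R (w2 - w0)))\<^sup>2
        + (\<delta>1 * (norm (w1 - w0))\<^sup>2 + \<delta>2 * (norm (w2 - w1))\<^sup>2 - \<nu>12 * (g1 \<bullet> (w2 - w1)))
      = (1/2) * (norm w0)\<^sup>2 + ((\<nu>11 + \<nu>12) * (g1 \<bullet> w1) + \<nu>22 * (g2 \<bullet> w2))"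
      using energy_identity[OF w1 w2, of w0 0 0 0 0 \<delta>1 l1 l2 0 \<delta>2 0 \<nu>11 \<nu>22 0 \<nu>12 0 0]
      by (simp add: \<delta>1_def \<delta>2_def \<nu>11_def \<nu>22_def \<nu>12_def algebra_simps)
    ultimately show "(1/2) * (norm (w0 + b 1 *\<^sub>R g1 + b 2 *\<^sub>R g2))\<^sup>2
        \<le> (1/2) * (norm w0)\<^sup>2 + ((\<nu>11 + \<nu>12) * (g1 \<bullet> w1) + \<nu>22 * (g2 \<bullet> w2))"
      using stable[THEN conjunct2, THEN conjunct2, THEN conjunct2, THEN conjunct2,
          rule_format, of w1 w0 w2]
      by (smt (verit))
  qed
qed

section \<open>Stability for two and three stages\<close>

lemma sum_1_2: "sum h {1..2::nat} = h 1 + h 2"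
  by (simp add: numeral_2_eq_2)

lemma sum_1_3: "sum h {1..3::nat} = h 1 + h 2 + h 3"
  by (simp add: numeral_3_eq_3 numeral_2_eq_2)

theorem corollary6p7:
  fixes \<iota> :: "'v::banach \<Rightarrow>\<^sub>L 'h::{real_inner,complete_space}"
    and tf :: real and u0 :: 'h
    and f :: "real \<Rightarrow> ('v \<Rightarrow>\<^sub>L real)" and \<A> :: "'v \<Rightarrow> ('v \<Rightarrow>\<^sub>L real)"
    and s :: nat and a :: "nat \<Rightarrow> nat \<Rightarrow> real" and b c :: "nat \<Rightarrow> real"
  assumes "gelfand_triple \<iota>"
    and "tf > 0"
    and "locally_solvable \<iota> \<A>"
    and coercive: "\<exists>p>1. \<exists>C1>0. \<forall>w. blinfun_apply (\<A> w) w \<ge> C1 * norm w powr p"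
    and "dirk_tableau s a b c"
    and "s = 2 \<or> s = 3"
    and "remarkably_stable TYPE('h) s a b"
  shows "discretely_Bochner_stable \<iota> tf u0 f \<A> s a b c"
proof -
  \<comment> \<open>The coercivity exponent becomes the exponent of the stability bound.\<close>
  obtain p C where pC: "p > 1" "C > 0" and coerc: "\<And>w. \<A> w w \<ge> C * norm w powr p"
    using coercive by blast
  have a_nz: "a i i \<noteq> 0" if "i \<in> {1..s}" for i
    using assms(5) that unfolding dirk_tableau_def by (metis less_irrefl)
  consider "s = 2" "remarkably_stable2 TYPE('h) a b" | "s = 3" "remarkably_stable3 TYPE('h) a b"
    using assms(7) unfolding remarkably_stable_def by blast
  then show ?thesis
  proof cases
    case 1
    have nz: "a 1 1 \<noteq> 0" "a 2 2 \<noteq> 0"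
      using 1(1) by (auto intro!: a_nz)
    obtain \<nu>1 \<nu>2 where \<nu>: "\<nu>1 > 0" "\<nu>2 > 0" and energy: "\<And>w0 w1 w2 g1 g2 :: 'h.
       w1 = w0 + a 1 1 *\<^sub>R g1 \<Longrightarrow>
       w2 = w0 + a 2 1 *\<^sub>R g1 + a 2 2 *\<^sub>R g2 \<Longrightarrow>
       (1/2) * (norm (w0 + b 1 *\<^sub>R g1 + b 2 *\<^sub>R g2))\<^sup>2
         \<le> (1/2) * (norm w0)\<^sup>2 + (\<nu>1 * (g1 \<bullet> w1) + \<nu>2 * (g2 \<bullet> w2))"
      by (rule remarkably_stable2_energy[OF 1(2) nz]) blast
    show ?thesis
    proof (rule discretely_Bochner_stableI[OF pC coerc, where \<nu> = "\<lambda>i. if i = 1 then \<nu>1 else \<nu>2"])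
      show "(if i = 1 then \<nu>1 else \<nu>2) > 0" for i :: nat
        using \<nu> by simp
      fix t m u v n
      assume run: "dirk_run \<iota> u0 f \<A> s a b c t m u v" "n < m"
      obtain G where G: "\<And>i. i \<in> {1..s} \<Longrightarrow>
          G i \<bullet> \<iota> (v n i) = time_step t n * (stage_load f c t n i - \<A> (v n i)) (v n i)"
        and v: "\<And>i. i \<in> {1..s} \<Longrightarrow> \<iota> (v n i) = u n + (\<Sum>j=1..i. a i j *\<^sub>R G j)"
        and u: "u (Suc n) = u n + (\<Sum>j=1..s. b j *\<^sub>R G j)"
        by (rule dirk_run_slopes[OF assms(1,5) run]) blast
      have v': "\<iota> (v n 1) = u n + a 1 1 *\<^sub>R G 1"
        "\<iota> (v n 2) = u n + a 2 1 *\<^sub>R G 1 + a 2 2 *\<^sub>R G 2"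
        using v[of 1] v[of 2] unfolding 1(1) sum_1_2 by (simp_all add: add.assoc)
      have u': "u (Suc n) = u n + b 1 *\<^sub>R G 1 + b 2 *\<^sub>R G 2"
        using u unfolding 1(1) sum_1_2 by (simp add: add.assoc)
      show "(1/2) * (norm (u (Suc n)))\<^sup>2 \<le> (1/2) * (norm (u n))\<^sup>2 + time_step t n *
          (\<Sum>i=1..s. (if i = 1 then \<nu>1 else \<nu>2) * (stage_load f c t n i - \<A> (v n i)) (v n i))"
        \<comment> \<open>Each \<open>G i\<close> carries the step size, so passing from inner
          products to pairings makes it a common factor of the sum.\<close>
        using energy[OF v'] G[of 1] G[of 2] unfolding u' 1(1) sum_1_2
        by (simp add: distrib_left mult.left_commute)
    qed
  next
    case 2
    have nz: "a 1 1 \<noteq> 0" "a 2 2 \<noteq> 0" "a 3 3 \<noteq> 0"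
      using 2(1) by (auto intro!: a_nz)
    obtain \<nu>1 \<nu>2 \<nu>3 where \<nu>: "\<nu>1 > 0" "\<nu>2 > 0" "\<nu>3 > 0"
      and energy: "\<And>w0 w1 w2 w3 g1 g2 g3 :: 'h.
       w1 = w0 + a 1 1 *\<^sub>R g1 \<Longrightarrow>
       w2 = w0 + a 2 1 *\<^sub>R g1 + a 2 2 *\<^sub>R g2 \<Longrightarrow>
       w3 = w0 + a 3 1 *\<^sub>R g1 + a 3 2 *\<^sub>R g2 + a 3 3 *\<^sub>R g3 \<Longrightarrow>
       (1/2) * (norm (w0 + b 1 *\<^sub>R g1 + b 2 *\<^sub>R g2 + b 3 *\<^sub>R g3))\<^sup>2
         \<le> (1/2) * (norm w0)\<^sup>2 + (\<nu>1 * (g1 \<bullet> w1) + \<nu>2 * (g2 \<bullet> w2) + \<nu>3 * (g3 \<bullet> w3))"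
      by (rule remarkably_stable3_energy[OF 2(2) nz]) blast
    \<comment> \<open>Indices beyond the stages receive the last weight, so positivity holds at
      every index.\<close>
    define \<nu> where "\<nu> i = (if i = 1 then \<nu>1 else if i = 2 then \<nu>2 else \<nu>3)" for i :: nat
    show ?thesis
    proof (rule discretely_Bochner_stableI[OF pC coerc, where \<nu> = \<nu>])
      show "\<nu> i > 0" for i
        using \<nu> by (simp add: \<nu>_def)
      fix t m u v n
      assume run: "dirk_run \<iota> u0 f \<A> s a b c t m u v" "n < m"
      obtain G where G: "\<And>i. i \<in> {1..s} \<Longrightarrow>
          G i \<bullet> \<iota> (v n i) = time_step t n * (stage_load f c t n i - \<A> (v n i)) (v n i)"
        and v: "\<And>i. i \<in> {1..s} \<Longrightarrow> \<iota> (v n i) = u n + (\<Sum>j=1..i. a i j *\<^sub>R G j)"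
        and u: "u (Suc n) = u n + (\<Sum>j=1..s. b j *\<^sub>R G j)"
        by (rule dirk_run_slopes[OF assms(1,5) run]) blast
      have v': "\<iota> (v n 1) = u n + a 1 1 *\<^sub>R G 1"
        "\<iota> (v n 2) = u n + a 2 1 *\<^sub>R G 1 + a 2 2 *\<^sub>R G 2"
        "\<iota> (v n 3) = u n + a 3 1 *\<^sub>R G 1 + a 3 2 *\<^sub>R G 2 + a 3 3 *\<^sub>R G 3"
        using v[of 1] v[of 2] v[of 3] unfolding 2(1) sum_1_2 sum_1_3
        by (simp_all add: add.assoc)
      have u': "u (Suc n) = u n + b 1 *\<^sub>R G 1 + b 2 *\<^sub>R G 2 + b 3 *\<^sub>R G 3"
        using u unfolding 2(1) sum_1_3 by (simp add: add.assoc)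
      show "(1/2) * (norm (u (Suc n)))\<^sup>2 \<le> (1/2) * (norm (u n))\<^sup>2 + time_step t n *
          (\<Sum>i=1..s. \<nu> i * (stage_load f c t n i - \<A> (v n i)) (v n i))"
        using energy[OF v'] G[of 1] G[of 2] G[of 3] unfolding u' 2(1) sum_1_3
        by (simp add: \<nu>_def distrib_left mult.left_commute)
    qed
  qed
qed

end
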